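(* Let $f=\frac1n\sum_{i=1}^n f_i:\mathbb{R}^d\to\mathbb{R}$, where each $f_i:\mathbb{R}^d\to\mathbb{R}$ is twice differentiable. Suppose there is a constant $L>0$ such that $\|\nabla^2 f(x)-\nabla^2 f(y)\|\le L\|x-y\|$ for all $x,y\in\mathbb{R}^d$, and a constant $\mu>0$ such that $\nabla^2 f(x)\succeq\mu I$ for all $x\in\mathbb{R}^d$. Let $M\ge0$ and let the initial point $x_0\in\mathbb{R}^d$ satisfy $$\|\nabla f(x_0)\|\le\frac{\mu^2}{2(M+3L)}.$$ Run the C2EDEN method (described in the context) with regularization parameter $M$ from $x_0$, producing iterates $x_d=x_0,x_{d+1},x_{d+2},\dots$. Then for every $k\ge d$, $$\|\nabla f(x_k)\|\le\frac{\mu^2}{M+3L}\left(\frac12\right)^{h(k)},$$ where $$h(k)=\left((1+d)^{\lfloor k/d\rfloor\%2}+k\%d\right)(1+d)^{\lfloor\lfloor k/d\rfloor/2\rfloor-1}.$$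
   Context: $\|\cdot\|$ is the Euclidean norm for vectors and the spectral norm for matrices; $I$ is the identity matrix; $e_1,\dots,e_d$ is the standard basis of $\mathbb{R}^d$; $a\%b$ is the remainder of $a$ divided by $b$. Cubic step: for $g\in\mathbb{R}^d$, a symmetric matrix $A\in\mathbb{R}^{d\times d}$ and $x\in\mathbb{R}^d$, $$T_M(g,A;x)=\arg\min_{y\in\mathbb{R}^d}\left\{\langle g,y-x\rangle+\tfrac12\langle A(y-x),y-x\rangle+\tfrac M6\|y-x\|^3\right\}.$$ C2EDEN method with input $x_0$, $M$: First, for $k=0,\dots,d-1$, the $i$-th client computes $v_{i,k}=\nabla^2 f_i(x_0)e_{k+1}$ and the server sets the $(k+1)$-th column of a matrix $H^+$ to $\frac1n\sum_{i}v_{i,k}$. Set $x_d=x_0$. Then for $k=d,d+1,\dots$: if $k\%d=0$, the server sets $\tilde x=x_k$ and $H=H^+$; each client $i$ computes and sends $v_{i,k}=\nabla^2 f_i(\tilde x)e_{k\%d+1}$ and $g_{i,k}=\nabla f_i(x_k)$; the server sets $g_k=\frac1n\sum_i g_{i,k}$ and $x_{k+1}=T_M(g_k,H;x_k)$, and overwrites the $(k\%d+1)$-th column of $H^+$ with $\frac1n\sum_i v_{i,k}$. Equivalently, $x_d=x_0$ and for all $k\ge d$, $$x_{k+1}=T_M\big(\nabla f(x_k),\nabla^2 f(x_{\tau(k;d)});x_k\big),\qquad \tau(k;d)=d\big(\lfloor k/d\rfloor-1\big).$$ *)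

theory Defs
  imports "HOL-Analysis.Analysis"
begin

definition gradient :: "(real ^ 'd \<Rightarrow> real) \<Rightarrow> real ^ 'd \<Rightarrow> real ^ 'd" where
  "gradient f x = (THE g. GDERIV f x :> g)"

definition hessian :: "(real ^ 'd \<Rightarrow> real) \<Rightarrow> real ^ 'd \<Rightarrow> real ^ 'd ^ 'd" where
  "hessian f x = jacobian (gradient f) (at x)"

definition twice_differentiable :: "(real ^ 'd \<Rightarrow> real) \<Rightarrow> bool" where
  "twice_differentiable f \<longleftrightarrow>
     (\<forall>x. f differentiable (at x)) \<and> (\<forall>x. gradient f differentiable (at x))"

definition spectral_norm :: "real ^ 'd ^ 'd \<Rightarrow> real" where
  "spectral_norm A = onorm (\<lambda>v. A *v v)"

(* The Loewner order.  Symmetry is not demanded here: it is automatic for the Hessians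
   to which the order is applied. *)
definition loewner_ge :: "real ^ 'd ^ 'd \<Rightarrow> real ^ 'd ^ 'd \<Rightarrow> bool" where
  "loewner_ge A B \<longleftrightarrow> (\<forall>v. 0 \<le> ((A - B) *v v) \<bullet> v)"

(* Arguments: regularization M, vector g, matrix A, centre x. *)
definition cubic_step ::
  "real \<Rightarrow> real ^ 'd \<Rightarrow> real ^ 'd ^ 'd \<Rightarrow> real ^ 'd \<Rightarrow> real ^ 'd" where
  "cubic_step M g A x =
     (ARG_MIN (\<lambda>y. g \<bullet> (y - x) + 1/2 * ((A *v (y - x)) \<bullet> (y - x)) + M/6 * norm (y - x) ^ 3)
        y. True)"

definition set_column :: "real ^ 'd ^ 'd \<Rightarrow> 'd \<Rightarrow> real ^ 'd \<Rightarrow> real ^ 'd ^ 'd" where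
  "set_column A j c = (\<chi> i l. if l = j then c $ i else A $ i $ l)"

definition client_average :: "nat \<Rightarrow> (nat \<Rightarrow> 'v) \<Rightarrow> 'v::real_vector" where
  "client_average n u = (1 / real n) *\<^sub>R (\<Sum>i = 1..n. u i)"

(* One execution of C2EDEN on the clients F 1, ..., F n.  The map idx numbers the
   coordinates: the j-th basis vector is axis (idx j) 1, for j = 1, ..., d.
   x k and Hp k are the iterate and the matrix H^+ at the beginning of round k;
   xt k and H k are the values of x~ and H in force during round k, after the possible
   update in that round (so H receives H^+ before a column of H^+ is overwritten).
   Hp 0, the matrix before any column has been set, is arbitrary, and so are
   the unused values x k, xt k, H k for k < d. *)
definition c2eden_run ::
  "(nat \<Rightarrow> 'd::finite) \<Rightarrow> nat \<Rightarrow> (nat \<Rightarrow> real ^ 'd \<Rightarrow> real) \<Rightarrow> real \<Rightarrow> real ^ 'd \<Rightarrow>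
   (nat \<Rightarrow> real ^ 'd) \<Rightarrow> (nat \<Rightarrow> real ^ 'd) \<Rightarrow>
   (nat \<Rightarrow> real ^ 'd ^ 'd) \<Rightarrow> (nat \<Rightarrow> real ^ 'd ^ 'd) \<Rightarrow> bool" where
  "c2eden_run idx n F M x0 x xt H Hp \<longleftrightarrow>
     (let d = CARD('d) in
       (\<forall>k < d. Hp (Suc k) = set_column (Hp k) (idx (k + 1))
          (client_average n (\<lambda>i. hessian (F i) x0 *v axis (idx (k + 1)) 1))) \<and>
       x d = x0 \<and>
       (\<forall>k \<ge> d.
          xt k = (if k mod d = 0 then x k else xt (k - 1)) \<and>
          H k = (if k mod d = 0 then Hp k else H (k - 1)) \<and>
          x (Suc k) = cubic_step M (client_average n (\<lambda>i. gradient (F i) (x k))) (H k) (x k) \<and>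
          Hp (Suc k) = set_column (Hp k) (idx (k mod d + 1))
            (client_average n (\<lambda>i. hessian (F i) (xt k) *v axis (idx (k mod d + 1)) 1))))"

(* The second exponent is -1 for k div d = 1, hence the integer power. *)
definition rate_exponent :: "nat \<Rightarrow> nat \<Rightarrow> real" where
  "rate_exponent d k =
     ((1 + real d) ^ ((k div d) mod 2) + real (k mod d)) *
     (1 + real d) powi (int ((k div d) div 2) - 1)"

end

theory Submission
  imports Defs
begin

text \<open>Each sweep of \<open>d\<close> rounds assembles the exact Hessian at the previous snapshot \<open>z\<close>, so every
  round is a cubic step with a stale Hessian. Stationarity of the cubic model bounds its
  length by \<open>\<parallel>\<nabla>f(x)\<parallel> / \<mu>\<close>, and strong convexity bounds the staleness \<open>\<parallel>x - z\<parallel>\<close> by gradient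
  norms. Writing \<open>a\<^sub>k = (M + 3L) \<parallel>\<nabla>f(x\<^sub>k)\<parallel> / \<mu>\<^sup>2\<close>, this gives
  \<open>a\<^sub>k\<^sub>+\<^sub>1 \<le> a\<^sub>k max(a\<^sub>k, a\<^sub>r)\<close> with \<open>r\<close> the snapshot round, and the exponent \<open>h\<close> satisfies
  \<open>h(r) \<le> h(k)\<close> and \<open>h(k + 1) \<le> h(k) + h(r)\<close>.\<close>

section \<open>Gradients and Hessians as derivatives\<close>

lemma gradient_eqI: "GDERIV f x :> g \<Longrightarrow> gradient f x = g"
  unfolding gradient_def
proof (rule the_equality)
  fix g'
  assume "GDERIV f x :> g" "GDERIV f x :> g'"
  then have "(\<lambda>h. h \<bullet> g') = (\<lambda>h. h \<bullet> g)"
    unfolding gderiv_def using has_derivative_unique by blast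
  then show "g' = g"
    by (metis (mono_tags) inner_commute vector_eq_rdot)
qed

text \<open>A linear functional on a Euclidean space is the inner product with the vector of its
  values on the basis. This is the existence half that lets the definite description in
  \<open>gradient\<close> denote something.\<close>

lemma GDERIV_gradient:
  fixes f :: "real ^ 'd \<Rightarrow> real"
  assumes "f differentiable (at x)"
  shows "GDERIV f x :> gradient f x"
proof -
  obtain f' where f': "(f has_derivative f') (at x)"
    using assms by (auto simp: differentiable_def)
  then interpret bounded_linear f'
    by (rule has_derivative_bounded_linear)
  have "f' h = h \<bullet> (\<Sum>i\<in>Basis. f' i *\<^sub>R i)" for h
  proof -
    have "f' h = f' (\<Sum>i\<in>Basis. (h \<bullet> i) *\<^sub>R i)"
      by (simp add: euclidean_representation)
    also have "\<dots> = (\<Sum>i\<in>Basis. (h \<bullet> i) * f' i)"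
      by (simp add: sum scaleR)
    finally show ?thesis
      by (simp add: inner_sum_right mult.commute)
  qed
  then have "f' = (\<lambda>h. h \<bullet> (\<Sum>i\<in>Basis. f' i *\<^sub>R i))" by blast
  then have "GDERIV f x :> (\<Sum>i\<in>Basis. f' i *\<^sub>R i)"
    using f' by (simp add: gderiv_def)
  with gradient_eqI show ?thesis by metis
qed

lemma has_derivative_gradient:
  assumes "twice_differentiable f"
  shows "(gradient f has_derivative (\<lambda>h. hessian f x *v h)) (at x)"
  using assms unfolding twice_differentiable_def hessian_def by (simp add: jacobian_works)

lemma hessian_eqI:
  assumes "(gradient f has_derivative (\<lambda>h. B *v h)) (at x)"
  shows "hessian f x = B"
proof -
  have "gradient f differentiable at x"
    using assms differentiable_def by blast
  then have "(gradient f has_derivative (\<lambda>h. hessian f x *v h)) (at x)"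
    by (simp add: hessian_def jacobian_works)
  then have "(\<lambda>h. hessian f x *v h) = (\<lambda>h. B *v h)"
    using assms has_derivative_unique by blast
  then show ?thesis
    by (metis matrix_eq)
qed

section \<open>Averages over the clients\<close>

text \<open>Matrix-vector multiplication is linear in the matrix. Through this, the Hessian columns
  sent by the clients average to a column of the Hessian of \<open>f\<close>.\<close>

lemma client_average_matrix_vector_mult:
  fixes A :: "nat \<Rightarrow> real ^ 'd ^ 'd"
  shows "client_average n A *v v = client_average n (\<lambda>i. A i *v v)"
proof -
  interpret linear "\<lambda>B. B *v v" for v :: "real ^ 'd"
    by unfold_locales (auto simp: matrix_vector_mult_add_rdistrib scaleR_matrix_vector_assoc)
  show ?thesis
    unfolding client_average_def by (simp add: scale sum)
qed

context
  fixes F :: "nat \<Rightarrow> real ^ 'd::finite \<Rightarrow> real" and f :: "real ^ 'd \<Rightarrow> real" and n :: nat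
  assumes f: "\<And>y. f y = 1 / real n * (\<Sum>i = 1..n. F i y)"
    and smooth: "\<And>i. i \<in> {1..n} \<Longrightarrow> twice_differentiable (F i)"
begin

lemma GDERIV_client_average:
  "GDERIV f x :> client_average n (\<lambda>i. gradient (F i) x)"
proof -
  have "GDERIV (F i) x :> gradient (F i) x" if "i \<in> {1..n}" for i
    using smooth[OF that] GDERIV_gradient by (auto simp: twice_differentiable_def)
  then have "((\<lambda>y. 1 / real n * (\<Sum>i = 1..n. F i y)) has_derivative
      (\<lambda>h. 1 / real n * (\<Sum>i = 1..n. h \<bullet> gradient (F i) x))) (at x)"
    unfolding gderiv_def
    by (intro has_derivative_mult_right has_derivative_sum) auto
  then show ?thesis
    unfolding gderiv_def client_average_def
    by (simp add: f[abs_def] inner_sum_right)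
qed

lemma gradient_client_average:
  "gradient f x = client_average n (\<lambda>i. gradient (F i) x)"
  by (rule gradient_eqI[OF GDERIV_client_average])

lemma has_derivative_gradient_client_average:
  "(gradient f has_derivative (\<lambda>h. client_average n (\<lambda>i. hessian (F i) x) *v h)) (at x)"
proof -
  have "gradient f = (\<lambda>y. client_average n (\<lambda>i. gradient (F i) y))"
    using gradient_client_average by blast
  moreover have "((\<lambda>y. client_average n (\<lambda>i. gradient (F i) y)) has_derivative
      (\<lambda>h. client_average n (\<lambda>i. hessian (F i) x *v h))) (at x)"
    unfolding client_average_def
    by (intro has_derivative_scaleR_right has_derivative_sum has_derivative_gradient smooth)
  ultimately show ?thesis
    by (simp add: client_average_matrix_vector_mult)
qed

lemma hessian_client_average:
  "hessian f x = client_average n (\<lambda>i. hessian (F i) x)"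
  by (rule hessian_eqI[OF has_derivative_gradient_client_average])

lemma twice_differentiable_client_average: "twice_differentiable f"
  unfolding twice_differentiable_def
  using GDERIV_client_average has_derivative_gradient_client_average
  by (auto simp: gderiv_def differentiable_def)

end

section \<open>Symmetry of the Hessian\<close>

text \<open>The second difference is symmetric in \<open>u\<close> and \<open>v\<close>, so this estimate yields the symmetry
  of the Hessian without assuming its continuity.\<close>

lemma second_difference_estimate:
  assumes f: "twice_differentiable f" and e: "e > 0"
  shows "\<exists>\<delta>>0. \<forall>t. 0 < t \<longrightarrow> t < \<delta> \<longrightarrow>
    \<bar>f (x + t *\<^sub>R u + t *\<^sub>R v) - f (x + t *\<^sub>R u) - f (x + t *\<^sub>R v) + f x - t\<^sup>2 * ((hessian f x *v v) \<bullet> u)\<bar>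
      \<le> e * t\<^sup>2 * ((2 * norm u + norm v) * norm u)"
proof -
  let ?G = "gradient f" and ?B = "hessian f x"
  \<comment> \<open>For \<open>t < r / ?K\<close> and \<open>0 < s < t\<close>, the points
    \<open>x + t *\<^sub>R v + s *\<^sub>R u\<close> and \<open>x + s *\<^sub>R u\<close> lie within
    \<open>r\<close> of \<open>x\<close>. The summand 1 keeps the divisor positive.\<close>
  let ?K = "norm u + norm v + 1"
  from has_derivative_gradient[OF f, of x] e obtain r where r: "r > 0"
    and Taylor: "\<And>y. norm (y - x) < r \<Longrightarrow> norm (?G y - ?G x - ?B *v (y - x)) \<le> e * norm (y - x)"
    unfolding has_derivative_at_alt by metis
  have K: "?K > 0" by (simp add: add_nonneg_pos)
  show ?thesis
  proof (intro exI[of _ "r / ?K"] conjI allI impI)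
    show "0 < r / ?K" using r K by simp
    fix t assume t: "0 < t" "t < r / ?K"
    \<comment> \<open>The second difference is the increment of \<open>\<phi>\<close> from 0 to
      \<open>t\<close>. One application of the mean value theorem turns it into a difference of two
      gradients near \<open>x\<close>, and differentiability of the gradient at the single point
      \<open>x\<close> then suffices.\<close>
    define \<phi> where "\<phi> s = f (x + s *\<^sub>R u + t *\<^sub>R v) - f (x + s *\<^sub>R u)" for s
    have D: "GDERIV f y :> ?G y" for y
      using f GDERIV_gradient by (auto simp: twice_differentiable_def)
    have Df: "((\<lambda>s. f (y + s *\<^sub>R u)) has_derivative (\<lambda>h. h * (?G (y + s *\<^sub>R u) \<bullet> u))) (at s)" for y s
    proof -
      have "((\<lambda>s. y + s *\<^sub>R u) has_derivative (\<lambda>h. h *\<^sub>R u)) (at s)"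
        by (auto intro!: derivative_eq_intros)
      from has_derivative_compose[OF this D[unfolded gderiv_def]]
      show ?thesis by (simp add: inner_commute)
    qed
    have "\<phi> = (\<lambda>s. f (x + t *\<^sub>R v + s *\<^sub>R u) - f (x + s *\<^sub>R u))"
      by (auto simp: \<phi>_def algebra_simps)
    then have "(\<phi> has_derivative
        (\<lambda>h. h * ((?G (x + t *\<^sub>R v + s *\<^sub>R u) - ?G (x + s *\<^sub>R u)) \<bullet> u))) (at s)" for s
      using has_derivative_diff[OF Df[of "x + t *\<^sub>R v"] Df[of x]]
      by (simp add: algebra_simps)
    then have "\<exists>s\<in>{0<..<t}. \<phi> t - \<phi> 0
        = (t - 0) * ((?G (x + t *\<^sub>R v + s *\<^sub>R u) - ?G (x + s *\<^sub>R u)) \<bullet> u)"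
      by (intro mvt_simple t) (auto intro: has_derivative_at_withinI)
    then obtain s where s: "0 < s" "s < t"
      and mvt: "\<phi> t - \<phi> 0 = t * ((?G (x + t *\<^sub>R v + s *\<^sub>R u) - ?G (x + s *\<^sub>R u)) \<bullet> u)" by auto
    let ?w = "t *\<^sub>R v + s *\<^sub>R u"
    have su: "norm (s *\<^sub>R u) \<le> t * norm u"
      using s by (auto intro: mult_right_mono)
    have w: "norm ?w \<le> t * (norm u + norm v)"
      using norm_triangle_ineq[of "t *\<^sub>R v" "s *\<^sub>R u"] su t by (simp add: algebra_simps)
    have "t * (norm u + norm v) < r"
      using t K by (simp add: field_simps)
    moreover have "t * norm u \<le> t * (norm u + norm v)" using t by simp
    ultimately have small: "norm ?w < r" "norm (s *\<^sub>R u) < r"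
      using w su by linarith+
    define a where "a = ?G (x + ?w) - ?G x - ?B *v ?w"
    define b where "b = ?G (x + s *\<^sub>R u) - ?G x - ?B *v (s *\<^sub>R u)"
    have "norm a \<le> e * norm ?w" "norm b \<le> e * norm (s *\<^sub>R u)"
      using Taylor[of "x + ?w"] Taylor[of "x + s *\<^sub>R u"] small by (simp_all add: a_def b_def)
    moreover have "e * norm ?w \<le> e * (t * (norm u + norm v))"
      "e * norm (s *\<^sub>R u) \<le> e * (t * norm u)"
      using w su e by auto
    ultimately have "norm (a - b) \<le> e * t * (2 * norm u + norm v)"
      using norm_triangle_ineq4[of a b] by (simp add: algebra_simps)
    then have ab: "\<bar>(a - b) \<bullet> u\<bar> \<le> e * t * (2 * norm u + norm v) * norm u"
      by (meson Cauchy_Schwarz_ineq2 mult_right_mono norm_ge_zero order_trans)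
    \<comment> \<open>The linear parts at the two points share the contribution of
      \<open>s *\<^sub>R u\<close>, so the unknown \<open>s\<close> survives only in the remainders
      \<open>a\<close> and \<open>b\<close>.\<close>
    have "?G (x + t *\<^sub>R v + s *\<^sub>R u) - ?G (x + s *\<^sub>R u) = t *\<^sub>R (?B *v v) + (a - b)"
      by (simp add: a_def b_def algebra_simps matrix_vector_right_distrib matrix_vector_mult_scaleR)
    then have "\<phi> t - \<phi> 0 - t\<^sup>2 * ((?B *v v) \<bullet> u) = t * ((a - b) \<bullet> u)"
      unfolding mvt by (simp only: inner_add_left inner_scaleR_left power2_eq_square) (simp add: distrib_left)
    then have "\<bar>\<phi> t - \<phi> 0 - t\<^sup>2 * ((?B *v v) \<bullet> u)\<bar> = t * \<bar>(a - b) \<bullet> u\<bar>"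
      using t by (simp add: abs_mult)
    also have "\<dots> \<le> t * (e * t * (2 * norm u + norm v) * norm u)"
      using ab t by (intro mult_left_mono) auto
    finally show "\<bar>f (x + t *\<^sub>R u + t *\<^sub>R v) - f (x + t *\<^sub>R u) - f (x + t *\<^sub>R v) + f x
        - t\<^sup>2 * ((?B *v v) \<bullet> u)\<bar> \<le> e * t\<^sup>2 * ((2 * norm u + norm v) * norm u)"
      by (simp add: \<phi>_def power2_eq_square algebra_simps)
  qed
qed

text \<open>Both orders of the directions approximate the same second difference; divide by
  \<open>t\<^sup>2\<close> and let the error tend to 0. Symmetry is wanted because the gradient of
  the quadratic term of the cubic model is \<open>A *v s\<close> only for symmetric
  \<open>A\<close>, and \<open>loewner_ge\<close> does not include it.\<close>

lemma hessian_symmetric: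
  assumes f: "twice_differentiable f"
  shows "(hessian f x *v u) \<bullet> v = (hessian f x *v v) \<bullet> u"
proof -
  let ?B = "hessian f x"
  define K where "K = (2 * norm u + norm v) * norm u + (2 * norm v + norm u) * norm v"
  have "\<bar>(?B *v u) \<bullet> v - (?B *v v) \<bullet> u\<bar> \<le> e * K" if e: "e > 0" for e
  proof -
    obtain \<delta>1 where \<delta>1: "\<delta>1 > 0" "\<And>t. 0 < t \<Longrightarrow> t < \<delta>1 \<Longrightarrow>
        \<bar>f (x + t *\<^sub>R u + t *\<^sub>R v) - f (x + t *\<^sub>R u) - f (x + t *\<^sub>R v) + f x - t\<^sup>2 * ((?B *v v) \<bullet> u)\<bar>
          \<le> e * t\<^sup>2 * ((2 * norm u + norm v) * norm u)"
      using second_difference_estimate[OF f e] by metis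
    obtain \<delta>2 where \<delta>2: "\<delta>2 > 0" "\<And>t. 0 < t \<Longrightarrow> t < \<delta>2 \<Longrightarrow>
        \<bar>f (x + t *\<^sub>R v + t *\<^sub>R u) - f (x + t *\<^sub>R v) - f (x + t *\<^sub>R u) + f x - t\<^sup>2 * ((?B *v u) \<bullet> v)\<bar>
          \<le> e * t\<^sup>2 * ((2 * norm v + norm u) * norm v)"
      using second_difference_estimate[OF f e] by metis
    define t where "t = min \<delta>1 \<delta>2 / 2"
    have t: "0 < t" "t < \<delta>1" "t < \<delta>2" using \<delta>1(1) \<delta>2(1) by (auto simp: t_def)
    have swap: "x + t *\<^sub>R v + t *\<^sub>R u = x + t *\<^sub>R u + t *\<^sub>R v" by (simp add: algebra_simps)
    have "\<bar>t\<^sup>2 * ((?B *v u) \<bullet> v) - t\<^sup>2 * ((?B *v v) \<bullet> u)\<bar> \<le> e * t\<^sup>2 * K"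
      using \<delta>1(2)[OF t(1,2)] \<delta>2(2)[OF t(1,3)]
      unfolding K_def swap distrib_left by linarith
    then have "t\<^sup>2 * \<bar>(?B *v u) \<bullet> v - (?B *v v) \<bullet> u\<bar> \<le> t\<^sup>2 * (e * K)"
      by (simp add: abs_mult flip: right_diff_distrib) (simp add: algebra_simps)
    then show ?thesis using t by simp
  qed
  then have "\<bar>(?B *v u) \<bullet> v - (?B *v v) \<bullet> u\<bar> \<le> 0 + e" if "e > 0" for e
  proof -
    have "K \<ge> 0" by (simp add: K_def)
    \<comment> \<open>\<open>K\<close> vanishes when both directions are zero, hence the division by
      \<open>K + 1\<close>.\<close>
    then have "e / (K + 1) * K \<le> e" "e / (K + 1) > 0"
      using that by (auto simp: field_simps)
    then show ?thesis
      using \<open>\<And>e. e > 0 \<Longrightarrow> \<bar>(?B *v u) \<bullet> v - (?B *v v) \<bullet> u\<bar> \<le> e * K\<close>[of "e / (K + 1)"] by linarith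
  qed
  from field_le_epsilon[OF this] show ?thesis by simp
qed

section \<open>Lipschitz Hessians and strong convexity\<close>

lemma norm_matrix_vector_mult_le_spectral_norm:
  "norm (A *v v) \<le> spectral_norm A * norm v"
  unfolding spectral_norm_def by (intro onorm linear_linear[THEN iffD1]) simp

text \<open>The optimal constant is \<open>L/2\<close>; the cruder \<open>L\<close> is still absorbed by \<open>M + 3 * L\<close>.\<close>

lemma gradient_linearization_bound:
  assumes f: "twice_differentiable f"
    and L: "L \<ge> 0"
    and lipschitz: "\<And>y z. spectral_norm (hessian f y - hessian f z) \<le> L * norm (y - z)"
  shows "norm (gradient f y - gradient f x - hessian f x *v (y - x)) \<le> L * (norm (y - x))\<^sup>2"
proof -
  let ?S = "closed_segment x y"
  let ?B = "\<lambda>z h. hessian f z *v h"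
  have seg: "x + t *\<^sub>R (y - x) \<in> ?S" if "t \<in> {0..1}" for t
    using that by (auto simp: in_segment algebra_simps)
  have der: "(gradient f has_derivative ?B z) (at z within ?S)" for z
    by (rule has_derivative_at_withinI[OF has_derivative_gradient[OF f]])
  have bound: "onorm (?B z - ?B x) \<le> L * norm (y - x)" if z: "z \<in> ?S" for z
  proof -
    have "?B z - ?B x = (\<lambda>h. (hessian f z - hessian f x) *v h)"
      by (rule ext) (simp add: matrix_vector_mult_diff_rdistrib)
    then have "onorm (?B z - ?B x) = spectral_norm (hessian f z - hessian f x)"
      by (simp only: spectral_norm_def)
    also have "\<dots> \<le> L * norm (z - x)" by (rule lipschitz)
    also have "\<dots> \<le> L * norm (y - x)"
      using segment_bound1[OF z] L by (simp add: mult_left_mono)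
    finally show ?thesis .
  qed
  have "norm (gradient f y - gradient f x - ?B x (y - x)) \<le> norm (y - x) * (L * norm (y - x))"
    by (rule differentiable_bound_linearization[OF seg der bound ends_in_segment(1)])
  then show ?thesis by (simp add: power2_eq_square algebra_simps)
qed

lemma loewner_ge_scaleR_mat_iff:
  "loewner_ge A (\<mu> *\<^sub>R mat 1) \<longleftrightarrow> (\<forall>v. \<mu> * (norm v)\<^sup>2 \<le> (A *v v) \<bullet> v)"
  by (simp add: loewner_ge_def matrix_vector_mult_diff_rdistrib inner_diff_left power2_norm_eq_inner
      flip: scaleR_matrix_vector_assoc)

text \<open>The mean value theorem for the gradient's component along the segment gives strong
  monotonicity, and Cauchy-Schwarz removes one factor of the distance. The staleness of a snapshot
  can thus be measured by two gradients, without summing the steps in between.\<close>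

lemma strong_convexity_gradient_bound:
  assumes f: "twice_differentiable f"
    and convex: "\<And>y. loewner_ge (hessian f y) (\<mu> *\<^sub>R mat 1)"
  shows "\<mu> * norm (y - x) \<le> norm (gradient f y - gradient f x)"
proof (cases "y = x")
  case False
  define v where "v = y - x"
  define \<phi> where "\<phi> t = gradient f (x + t *\<^sub>R v) \<bullet> v" for t
  have "(\<phi> has_derivative (\<lambda>h. h * ((hessian f (x + t *\<^sub>R v) *v v) \<bullet> v))) (at t)" for t
  proof -
    have "((\<lambda>t. x + t *\<^sub>R v) has_derivative (\<lambda>h. h *\<^sub>R v)) (at t)"
      by (auto intro!: derivative_eq_intros)
    from has_derivative_inner_left[OF has_derivative_compose[OF this has_derivative_gradient[OF f]]]
    show ?thesis
      unfolding \<phi>_def by (simp add: matrix_vector_mult_scaleR)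
  qed
  then have "\<exists>t\<in>{0<..<1}. \<phi> 1 - \<phi> 0 = (1 - 0) * ((hessian f (x + t *\<^sub>R v) *v v) \<bullet> v)"
    by (intro mvt_simple) (auto intro: has_derivative_at_withinI)
  then obtain t where "\<phi> 1 - \<phi> 0 = (hessian f (x + t *\<^sub>R v) *v v) \<bullet> v"
    by auto
  also have "\<dots> \<ge> \<mu> * (norm v)\<^sup>2"
    using convex loewner_ge_scaleR_mat_iff by blast
  finally have "\<mu> * (norm v)\<^sup>2 \<le> (gradient f y - gradient f x) \<bullet> v"
    by (simp add: \<phi>_def v_def inner_diff_left)
  also have "\<dots> \<le> norm (gradient f y - gradient f x) * norm v"
    by (rule norm_cauchy_schwarz)
  finally show ?thesis
    using False by (simp add: v_def power2_eq_square)
qed simp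

section \<open>The cubic model: minimizers, stationarity, step length\<close>

text \<open>The objective of \<open>cubic_step\<close> in terms of the displacement from the
  centre.\<close>

definition cubic_model :: "real \<Rightarrow> real ^ 'd \<Rightarrow> real ^ 'd ^ 'd \<Rightarrow> real ^ 'd \<Rightarrow> real" where
  "cubic_model M g A s = g \<bullet> s + 1/2 * ((A *v s) \<bullet> s) + M/6 * norm s ^ 3"

text \<open>Beyond radius \<open>2 * norm g / \<mu>\<close> the quadratic term outweighs the linear
  one, so the model is at least 0, its value at the origin. A minimizer over the compact ball is
  therefore global, also for \<open>M = 0\<close>.\<close>

lemma cubic_model_has_minimizer:
  fixes g :: "real ^ 'd"
  assumes M: "M \<ge> 0" and mu: "\<mu> > 0"
    and A: "loewner_ge A (\<mu> *\<^sub>R mat 1)"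
  shows "\<exists>s. \<forall>y. cubic_model M g A s \<le> cubic_model M g A y"
proof -
  let ?R = "2 * norm g / \<mu>"
  have "0 \<in> cball (0 :: real ^ 'd) ?R" using mu by simp
  moreover have "continuous_on (cball 0 ?R) (cubic_model M g A)"
    unfolding cubic_model_def
    by (intro continuous_intros linear_continuous_on linear_linear[THEN iffD1]) simp
  ultimately have "\<exists>s\<in>cball 0 ?R. \<forall>y\<in>cball 0 ?R. cubic_model M g A s \<le> cubic_model M g A y"
    by (intro continuous_attains_inf[OF compact_cball]) blast+
  then obtain s where s: "\<And>y. y \<in> cball 0 ?R \<Longrightarrow> cubic_model M g A s \<le> cubic_model M g A y"
    by blast
  have "cubic_model M g A s \<le> cubic_model M g A y" if "y \<notin> cball 0 ?R" for y
  proof -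
    have y: "norm y > ?R" using that by simp
    have "cubic_model M g A s \<le> cubic_model M g A 0" using s[of 0] mu by simp
    also have "\<dots> = 0" by (simp add: cubic_model_def)
    also have "0 \<le> norm y * (\<mu> / 2 * norm y - norm g)"
      using y mu by (intro mult_nonneg_nonneg) (auto simp: field_simps)
    also have "\<dots> = - (norm g * norm y) + 1/2 * (\<mu> * (norm y)\<^sup>2)"
      by (simp add: power2_eq_square algebra_simps)
    also have "\<dots> \<le> g \<bullet> y + 1/2 * ((A *v y) \<bullet> y)"
      using A Cauchy_Schwarz_ineq2[of g y] unfolding loewner_ge_scaleR_mat_iff
      by (intro add_mono) (auto simp: abs_le_iff)
    also have "\<dots> \<le> cubic_model M g A y" using M by (simp add: cubic_model_def)
    finally show ?thesis .
  qed
  then show ?thesis using s by blast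
qed

text \<open>This replaces differentiation at a minimum: a one-sided quadratic bound on the variation
  already forces the first-order term to vanish.\<close>

lemma linear_coefficient_eq_0:
  fixes c C :: real
  assumes "\<And>t. \<bar>t\<bar> \<le> 1 \<Longrightarrow> 0 \<le> t * c + t\<^sup>2 * C"
  shows "c = 0"
proof (rule ccontr)
  assume c: "c \<noteq> 0"
  \<comment> \<open>With this \<open>D\<close> the trial value \<open>t = - c / D\<close> stays in
    the unit interval, and the bound becomes \<open>- \<bar>c\<bar> ^ 3 / D\<^sup>2\<close>, which
    is negative.\<close>
  define D where "D = \<bar>c\<bar> + \<bar>C\<bar>"
  have D: "D > 0" using c by (simp add: D_def add_pos_nonneg)
  define t where "t = - c / D"
  have t: "\<bar>t\<bar> \<le> 1" using D by (simp add: t_def abs_div) (simp add: D_def)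
  have "t * c + t\<^sup>2 * C \<le> t * c + t\<^sup>2 * \<bar>C\<bar>" by (intro add_left_mono mult_left_mono) auto
  also have "\<dots> = - (c\<^sup>2 * (D - \<bar>C\<bar>)) / D\<^sup>2"
    using D by (simp add: t_def field_simps power2_eq_square)
  also have "\<dots> < 0" using c D by (auto simp: D_def divide_less_0_iff)
  finally show False using assms[OF t] by linarith
qed

text \<open>The cubic term is controlled through the identity
  \<open>r\<^sup>3 - q\<^sup>3 = 3/2 q (r\<^sup>2 - q\<^sup>2) + (r - q)\<^sup>2 (r + q/2)\<close>, which avoids differentiating the
  norm and treats \<open>q = 0\<close> on the same footing.\<close>

lemma norm_cube_add_le:
  fixes s h :: "'a::real_inner"
  assumes "\<bar>t\<bar> \<le> 1"
  shows "norm (s + t *\<^sub>R h) ^ 3 \<le> norm s ^ 3 + t * (3 * norm s * (s \<bullet> h))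
    + t\<^sup>2 * (3/2 * norm s * (norm h)\<^sup>2 + (norm h)\<^sup>2 * (norm h + 3/2 * norm s))"
proof -
  let ?r = "norm (s + t *\<^sub>R h)" and ?q = "norm s"
  have th: "norm (t *\<^sub>R h) = \<bar>t\<bar> * norm h" by simp
  have "\<bar>t\<bar> * norm h \<le> norm h" using assms by (simp add: mult_left_le_one_le)
  then have r: "?r \<le> ?q + norm h" using norm_triangle_ineq[of s "t *\<^sub>R h"] by simp
  have "\<bar>?r - ?q\<bar> \<le> \<bar>t\<bar> * norm h"
    using norm_triangle_ineq3[of "s + t *\<^sub>R h" s] by simp
  then have "(?r - ?q)\<^sup>2 \<le> (\<bar>t\<bar> * norm h)\<^sup>2"
    by (metis abs_ge_zero power2_abs power_mono)
  then have "(?r - ?q)\<^sup>2 * (?r + ?q / 2) \<le> (\<bar>t\<bar> * norm h)\<^sup>2 * (norm h + 3/2 * ?q)"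
    using r by (intro mult_mono) auto
  moreover have "?r\<^sup>2 - ?q\<^sup>2 = 2 * t * (s \<bullet> h) + t\<^sup>2 * (norm h)\<^sup>2"
    unfolding power2_norm_eq_inner
    by (simp add: inner_add_left inner_add_right inner_commute[of h s] power2_eq_square algebra_simps)
  moreover have "?r ^ 3 = ?q ^ 3 + 3/2 * ?q * (?r\<^sup>2 - ?q\<^sup>2) + (?r - ?q)\<^sup>2 * (?r + ?q / 2)"
    by (simp add: power2_eq_square power3_eq_cube algebra_simps)
  ultimately show ?thesis
    by (simp add: power_mult_distrib algebra_simps)
qed

text \<open>Along each direction \<open>h\<close> the variation of the model is at most
  \<open>t\<close> times \<open>?w \<bullet> h\<close> plus a multiple of \<open>t\<^sup>2\<close>,
  so \<open>?w\<close> is orthogonal to every \<open>h\<close>.\<close>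

lemma cubic_model_stationary:
  assumes M: "M \<ge> 0"
    and sym: "\<And>u v. (A *v u) \<bullet> v = (A *v v) \<bullet> u"
    and min: "\<And>y. cubic_model M g A s \<le> cubic_model M g A y"
  shows "g + A *v s + (M / 2 * norm s) *\<^sub>R s = 0"
proof -
  let ?w = "g + A *v s + (M / 2 * norm s) *\<^sub>R s"
  have "?w \<bullet> h = 0" for h
  proof (rule linear_coefficient_eq_0)
    fix t :: real
    assume t: "\<bar>t\<bar> \<le> 1"
    let ?C = "3/2 * norm s * (norm h)\<^sup>2 + (norm h)\<^sup>2 * (norm h + 3/2 * norm s)"
    have "cubic_model M g A s \<le> cubic_model M g A (s + t *\<^sub>R h)" by (rule min)
    also have "\<dots> \<le> g \<bullet> (s + t *\<^sub>R h) + 1/2 * ((A *v (s + t *\<^sub>R h)) \<bullet> (s + t *\<^sub>R h))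
        + M/6 * (norm s ^ 3 + t * (3 * norm s * (s \<bullet> h)) + t\<^sup>2 * ?C)"
      unfolding cubic_model_def using M norm_cube_add_le[OF t, of s h]
      by (intro add_left_mono mult_left_mono) auto
    also have "\<dots> = cubic_model M g A s + t * (?w \<bullet> h)
        + t\<^sup>2 * (1/2 * ((A *v h) \<bullet> h) + M/6 * ?C)"
      unfolding cubic_model_def
      by (simp add: matrix_vector_right_distrib matrix_vector_mult_scaleR inner_add_left
          inner_add_right sym[of h s] power2_eq_square algebra_simps)
    finally show "0 \<le> t * (?w \<bullet> h) + t\<^sup>2 * (1/2 * ((A *v h) \<bullet> h) + M/6 * ?C)"
      by linarith
  qed
  then show ?thesis using inner_eq_zero_iff by blast
qed

lemma cubic_step_stationary:
  assumes M: "M \<ge> 0" and mu: "\<mu> > 0"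
    and A: "loewner_ge A (\<mu> *\<^sub>R mat 1)"
    and sym: "\<And>u v. (A *v u) \<bullet> v = (A *v v) \<bullet> u"
    and s: "s = cubic_step M g A x - x"
  shows "g + A *v s + (M / 2 * norm s) *\<^sub>R s = 0"
proof (rule cubic_model_stationary[OF M sym])
  fix y
  let ?P = "\<lambda>z. is_arg_min (\<lambda>y. cubic_model M g A (y - x)) (\<lambda>_. True) z"
  obtain s0 where "\<And>y. cubic_model M g A s0 \<le> cubic_model M g A y"
    using cubic_model_has_minimizer[OF M mu A] by blast
  \<comment> \<open>\<open>ARG_MIN\<close> is a choice operator: once some minimizer exists,
    whichever point it picks is one.\<close>
  then have "?P (x + s0)" by (simp add: is_arg_min_linorder)
  then have "?P (cubic_step M g A x)"
    unfolding cubic_step_def arg_min_def cubic_model_def[symmetric] by (rule someI)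
  then have "cubic_model M g A s \<le> cubic_model M g A (x + y - x)"
    unfolding is_arg_min_linorder s by blast
  then show "cubic_model M g A s \<le> cubic_model M g A y" by simp
qed

text \<open>Pair the stationarity equation with \<open>s\<close>: the cubic term contributes with a
  favourable sign and is dropped.\<close>

lemma cubic_step_norm_le:
  assumes M: "M \<ge> 0"
    and A: "loewner_ge A (\<mu> *\<^sub>R mat 1)"
    and stat: "g + A *v s + (M / 2 * norm s) *\<^sub>R s = 0"
  shows "\<mu> * norm s \<le> norm g"
proof (cases "s = 0")
  case False
  have "\<mu> * (norm s)\<^sup>2 \<le> (A *v s) \<bullet> s"
    using A loewner_ge_scaleR_mat_iff by blast
  also have "\<dots> \<le> (A *v s) \<bullet> s + (M / 2 * norm s) * (norm s)\<^sup>2"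
    using M by simp
  also have "\<dots> = - g \<bullet> s"
    using arg_cong[OF stat, of "\<lambda>w. w \<bullet> s"]
    by (simp add: inner_add_left power2_norm_eq_inner)
  also have "\<dots> \<le> norm g * norm s"
    using norm_cauchy_schwarz[of "- g" s] by simp
  finally show ?thesis using False by (simp add: power2_eq_square)
qed simp

section \<open>One cubic step with a stale Hessian\<close>

text \<open>Subtracting the stationarity equation writes the new gradient as a linearization error,
  plus the effect of using the Hessian at \<open>z\<close> instead of \<open>x\<close>, minus the
  cubic term. Each carries a factor \<open>norm s\<close>, bounded by the gradient at
  \<open>x\<close> alone; the remaining factor is bounded by the maximum.\<close>

lemma lazy_cubic_step_gradient_bound:
  fixes f :: "real ^ 'd \<Rightarrow> real"
  assumes f: "twice_differentiable f"
    and L: "L > 0"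
    and lipschitz: "\<And>y z. spectral_norm (hessian f y - hessian f z) \<le> L * norm (y - z)"
    and mu: "\<mu> > 0"
    and convex: "\<And>y. loewner_ge (hessian f y) (\<mu> *\<^sub>R mat 1)"
    and M: "M \<ge> 0"
    and y: "y = cubic_step M (gradient f x) (hessian f z) x"
  shows "norm (gradient f y) \<le> (M + 3 * L) / \<mu>\<^sup>2 *
    (norm (gradient f x) * max (norm (gradient f x)) (norm (gradient f z)))"
proof -
  let ?G = "gradient f" and ?B = "hessian f"
  let ?m = "max (norm (?G x)) (norm (?G z))"
  define s where "s = y - x"
  have stat: "?G x + ?B z *v s + (M / 2 * norm s) *\<^sub>R s = 0"
    by (rule cubic_step_stationary[OF M mu convex hessian_symmetric[OF f]]) (simp add: s_def y)
  have s_x: "\<mu> * norm s \<le> norm (?G x)"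
    by (rule cubic_step_norm_le[OF M convex stat])
  then have s: "\<mu> * norm s \<le> ?m" by simp
  have "\<mu> * norm (x - z) \<le> norm (?G x - ?G z)"
    by (rule strong_convexity_gradient_bound[OF f convex])
  then have xz: "\<mu> * norm (x - z) \<le> 2 * ?m"
    using norm_triangle_ineq4[of "?G x" "?G z"] by linarith
  have "?G y = (?G y - ?G x - ?B x *v s) + (?B x - ?B z) *v s - (M / 2 * norm s) *\<^sub>R s"
    proof -
    have "?B z *v s + (M / 2 * norm s) *\<^sub>R s = - ?G x"
      using stat by (metis add.assoc add_eq_0_iff)
    then show ?thesis
      by (simp add: matrix_vector_mult_diff_rdistrib algebra_simps)
  qed
  moreover have "norm (p + q - r) \<le> norm p + norm q + norm r" for p q r :: "real ^ 'd"
    using norm_triangle_ineq4[of "p + q" r] norm_triangle_ineq[of p q] by linarith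
  ultimately have "norm (?G y) \<le> norm (?G y - ?G x - ?B x *v s) + norm ((?B x - ?B z) *v s)
      + norm ((M / 2 * norm s) *\<^sub>R s)"
    by metis
  also have "\<dots> \<le> L * (norm s)\<^sup>2 + L * norm (x - z) * norm s + M / 2 * (norm s)\<^sup>2"
  proof (intro add_mono)
    show "norm (?G y - ?G x - ?B x *v s) \<le> L * (norm s)\<^sup>2"
      unfolding s_def using gradient_linearization_bound[OF f _ lipschitz] L by simp
    show "norm ((?B x - ?B z) *v s) \<le> L * norm (x - z) * norm s"
      by (rule order_trans[OF norm_matrix_vector_mult_le_spectral_norm
            mult_right_mono[OF lipschitz norm_ge_zero]])
    show "norm ((M / 2 * norm s) *\<^sub>R s) \<le> M / 2 * (norm s)\<^sup>2"
      using M by (simp add: power2_eq_square)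
  qed
  also have "\<dots> = norm s * (L * norm s + L * norm (x - z) + M / 2 * norm s)"
    by (simp add: power2_eq_square algebra_simps)
  \<comment> \<open>Every term is a product of two lengths, and each length absorbs one factor
    \<open>\<mu>\<close>.\<close>
  finally have "\<mu>\<^sup>2 * norm (?G y) \<le>
      \<mu>\<^sup>2 * (norm s * (L * norm s + L * norm (x - z) + M / 2 * norm s))"
    using mu by simp
  also have "\<dots> = (\<mu> * norm s) *
      (L * (\<mu> * norm s) + L * (\<mu> * norm (x - z)) + M / 2 * (\<mu> * norm s))"
    by (simp add: power2_eq_square algebra_simps)
  \<comment> \<open>The constant \<open>M + 3 * L\<close> collects \<open>L\<close> from
    linearization, \<open>2 * L\<close> from staleness, as \<open>\<mu> * norm (x - z)\<close> is at
    most \<open>2 * ?m\<close>, and \<open>M / 2\<close> rounded up to \<open>M\<close>.\<close>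
  also have "\<dots> \<le> norm (?G x) * (L * ?m + L * (2 * ?m) + M * ?m)"
  proof (rule mult_mono[OF s_x])
    have "L * (\<mu> * norm s) \<le> L * ?m" "L * (\<mu> * norm (x - z)) \<le> L * (2 * ?m)"
      "M * (\<mu> * norm s) \<le> M * ?m"
      using L M s xz by (simp_all only: mult_left_mono less_imp_le)
    moreover have nonneg: "0 \<le> L * (\<mu> * norm s)" "0 \<le> L * (\<mu> * norm (x - z))"
      "0 \<le> M * (\<mu> * norm s)"
      using L M mu by simp_all
    ultimately show "L * (\<mu> * norm s) + L * (\<mu> * norm (x - z)) + M / 2 * (\<mu> * norm s)
        \<le> L * ?m + L * (2 * ?m) + M * ?m" by linarith
    show "0 \<le> L * (\<mu> * norm s) + L * (\<mu> * norm (x - z)) + M / 2 * (\<mu> * norm s)"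
      using nonneg by linarith
  qed simp
  also have "\<dots> = (M + 3 * L) * (norm (?G x) * ?m)"
    by (simp only: algebra_simps)
  finally have "norm (?G y) \<le> ((M + 3 * L) * (norm (?G x) * ?m)) / \<mu>\<^sup>2"
    using mu by (subst pos_le_divide_eq) (simp_all only: mult.commute zero_less_power)
  then show ?thesis by simp
qed

section \<open>Assembly of the Hessian in a run of C2EDEN\<close>

text \<open>After \<open>j\<close> writes the columns \<open>idx 1\<close>, ...,
  \<open>idx j\<close> agree with \<open>B\<close>: injectivity of \<open>idx\<close> protects those
  already written, and surjectivity makes the sweep reach all of them, whatever the matrix was
  before.\<close>

lemma set_column_sweep:
  fixes P :: "nat \<Rightarrow> real ^ 'd ^ 'd::finite"
  assumes idx: "bij_betw idx {1..CARD('d)} (UNIV :: 'd set)"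
    and step: "\<And>j. j < CARD('d) \<Longrightarrow>
      P (Suc j) = set_column (P j) (idx (j + 1)) (B *v axis (idx (j + 1)) 1)"
  shows "P CARD('d) = B"
proof -
  have "P j $ a $ idx i = B $ a $ idx i" if "j \<le> CARD('d)" "i \<in> {1..j}" for j i a
    using that
  proof (induction j)
    case (Suc j)
    then show ?case
      by (cases "i = Suc j")
        (auto simp: step set_column_def matrix_vector_mult_basis column_def
          dest: bij_betw_imp_inj_on[OF idx, THEN inj_onD])
  qed simp
  then have "P CARD('d) $ a $ b = B $ a $ b" for a b
    using bij_betw_imp_surj_on[OF idx] by (metis UNIV_I imageE order_refl)
  then show ?thesis by (simp add: vec_eq_iff)
qed

text \<open>In the first period the Hessian is taken at \<open>x0 = x d\<close>, so \<open>\<tau>(k; d) = 0\<close> is replaced by \<open>d\<close>.\<close>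

definition reference_round :: "nat \<Rightarrow> nat \<Rightarrow> nat" where
  "reference_round d k = max 1 (k div d - 1) * d"

lemma c2eden_run_step:
  fixes F :: "nat \<Rightarrow> real ^ 'd::finite \<Rightarrow> real"
  assumes f: "\<And>y. f y = 1 / real n * (\<Sum>i = 1..n. F i y)"
    and smooth: "\<And>i. i \<in> {1..n} \<Longrightarrow> twice_differentiable (F i)"
    and idx: "bij_betw idx {1..CARD('d)} UNIV"
    and run: "c2eden_run idx n F M x0 x xt H Hp"
    and k: "k \<ge> CARD('d)"
  shows "x (Suc k) =
    cubic_step M (gradient f (x k)) (hessian f (x (reference_round CARD('d) k))) (x k)"
proof -
  let ?d = "CARD('d)"
  have average: "client_average n (\<lambda>i. gradient (F i) y) = gradient f y"
    "client_average n (\<lambda>i. hessian (F i) y *v v) = hessian f y *v v" for y v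
    using gradient_client_average[of f, OF f smooth] hessian_client_average[of f, OF f smooth]
    by (simp_all add: client_average_matrix_vector_mult)
  have init: "\<And>k. k < ?d \<Longrightarrow>
      Hp (Suc k) = set_column (Hp k) (idx (k + 1)) (hessian f x0 *v axis (idx (k + 1)) 1)"
    and x: "x ?d = x0"
    and xt: "\<And>k. k \<ge> ?d \<Longrightarrow> xt k = (if k mod ?d = 0 then x k else xt (k - 1))"
    and H: "\<And>k. k \<ge> ?d \<Longrightarrow> H k = (if k mod ?d = 0 then Hp k else H (k - 1))"
    and step: "\<And>k. k \<ge> ?d \<Longrightarrow> x (Suc k) = cubic_step M (gradient f (x k)) (H k) (x k)"
    and Hp: "\<And>k. k \<ge> ?d \<Longrightarrow> Hp (Suc k) = set_column (Hp k) (idx (k mod ?d + 1))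
        (hessian f (xt k) *v axis (idx (k mod ?d + 1)) 1)"
    using run unfolding c2eden_run_def Let_def unfolding average by simp_all
  have d: "?d > 0" by simp
  \<comment> \<open>Within a period the snapshot and the Hessian in force are frozen at their values
    from its first round.\<close>
  have period: "xt (m * ?d + j) = x (m * ?d) \<and> H (m * ?d + j) = Hp (m * ?d)"
    if m: "m \<ge> 1" and j: "j < ?d" for m j
    using j
  proof (induction j)
    case 0
    show ?case using xt[of "m * ?d"] H[of "m * ?d"] m by simp
  next
    case (Suc j)
    have "?d \<le> m * ?d" using m by simp
    then have ge: "m * ?d + Suc j \<ge> ?d" by (rule trans_le_add1)
    have "(m * ?d + Suc j) mod ?d = Suc j"
      using Suc.prems by (simp only: mod_mult_self3 mod_less)
    then show ?case using xt[OF ge] H[OF ge] Suc by simp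
  qed
  have start: "Hp ?d = hessian f x0"
    by (rule set_column_sweep[OF idx init])
  \<comment> \<open>The columns written during period \<open>m\<close> all come from the snapshot
    \<open>x (m * ?d)\<close>, so \<open>Hp\<close> is that Hessian when period \<open>m + 1\<close>
    begins, just in time to be copied into \<open>H\<close>.\<close>
  have sweep: "Hp (Suc m * ?d) = hessian f (x (m * ?d))" if m: "m \<ge> 1" for m
  proof -
    have "Hp (m * ?d + ?d) = hessian f (x (m * ?d))"
    proof (rule set_column_sweep[OF idx, where P = "\<lambda>j. Hp (m * ?d + j)"])
      fix j assume j: "j < ?d"
      have "?d \<le> m * ?d" using m by simp
      then have "m * ?d + j \<ge> ?d" by (rule trans_le_add1)
      moreover have "(m * ?d + j) mod ?d = j"
        using j by (simp only: mod_mult_self3 mod_less)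
      ultimately show "Hp (m * ?d + Suc j) =
          set_column (Hp (m * ?d + j)) (idx (j + 1)) (hessian f (x (m * ?d)) *v axis (idx (j + 1)) 1)"
        using Hp period[OF m j] by (metis add_Suc_right)
    qed
    then show ?thesis by (simp add: add.commute)
  qed
  have m: "k div ?d \<ge> 1" using k d by (simp add: div_greater_zero_iff Suc_leI)
  then have "H k = Hp (k div ?d * ?d)"
    using period[of "k div ?d" "k mod ?d"] by simp
  also have "\<dots> = hessian f (x (reference_round ?d k))"
  proof (cases "k div ?d = 1")
    case True
    then show ?thesis using start x by (simp add: reference_round_def)
  next
    case False
    then obtain m where "k div ?d = Suc m" "m \<ge> 1"
      using m by (metis One_nat_def Suc_le_D Suc_leI neq0_conv)
    then show ?thesis using sweep[of m] by (simp add: reference_round_def)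
  qed
  finally show ?thesis using step[OF k] by simp
qed

section \<open>Arithmetic of the rate exponent\<close>

text \<open>The amount by which \<open>rate_exponent\<close> grows per round inside period
  \<open>m\<close>.\<close>

definition rate_increment :: "nat \<Rightarrow> nat \<Rightarrow> real" where
  "rate_increment d m = (1 + real d) powi (int (m div 2) - 1)"

lemma rate_exponent_period:
  assumes "j < d"
  shows "rate_exponent d (m * d + j) =
    ((1 + real d) ^ (m mod 2) + real j) * rate_increment d m"
  using assms by (simp add: rate_exponent_def rate_increment_def)

lemma rate_increment_pos: "rate_increment d m > 0"
  by (simp add: rate_increment_def add_pos_nonneg zero_less_power_int)

lemma rate_increment_Suc:
  "rate_increment d (Suc m) = (if even m then 1 else 1 + real d) * rate_increment d m"
proof (cases "even m")
  case False
  then have "Suc m div 2 = Suc (m div 2)" by presburger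
  moreover have "1 + real d \<noteq> 0" using of_nat_0_le_iff[of d] by linarith
  ultimately show ?thesis
    using False power_int_add_1'[of "1 + real d" "int (m div 2) - 1"]
    by (simp add: rate_increment_def)
qed (simp add: rate_increment_def)

lemma rate_exponent_mult:
  assumes "d > 0"
  shows "rate_exponent d (m * d) = (if even m then 1 else 1 + real d) * rate_increment d m"
  using rate_exponent_period[OF assms, of m] by (auto simp: odd_iff_mod_2_eq_one)

lemma rate_exponent_first_period:
  assumes "d > 0"
  shows "rate_exponent d d = 1"
  using rate_exponent_mult[OF assms, of 1] by (simp add: rate_increment_def power_int_minus)

text \<open>For \<open>m \<ge> 2\<close> the exponent at the previous snapshot equals the increment
  of period \<open>m\<close>, by the same parity formula. For \<open>m = 1\<close> the reference is
  the period's own start, with exponent 1 against an increment of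
  \<open>1 / (1 + d)\<close>.\<close>

lemma rate_exponent_reference_bounds:
  assumes d: "d > 0" and m: "m \<ge> 1"
  shows "rate_increment d m \<le> rate_exponent d (max 1 (m - 1) * d)"
    and "rate_exponent d (max 1 (m - 1) * d) \<le> rate_exponent d (m * d)"
proof -
  have "rate_increment d m \<le> rate_exponent d (max 1 (m - 1) * d) \<and>
    rate_exponent d (max 1 (m - 1) * d) \<le> rate_exponent d (m * d)"
  proof (cases "m = 1")
    case True
    then show ?thesis
      using rate_increment_pos[of d 1] by (simp add: rate_exponent_mult[OF d, of 1, simplified] algebra_simps)
  next
    case False
    then obtain l where l: "m = Suc l" "l \<ge> 1" using m by (cases m) auto
    then have "max 1 (m - 1) = l" by simp
    moreover have "rate_increment d l \<le> (1 + real d) * rate_increment d l"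
      using rate_increment_pos[of d l] by simp
    ultimately show ?thesis
      unfolding l(1) by (simp only: rate_exponent_mult[OF d] rate_increment_Suc) auto
  qed
  then show "rate_increment d m \<le> rate_exponent d (max 1 (m - 1) * d)"
    "rate_exponent d (max 1 (m - 1) * d) \<le> rate_exponent d (m * d)" by auto
qed

lemma rate_exponent_Suc_le:
  assumes d: "d > 0"
  shows "rate_exponent d (Suc k) \<le> rate_exponent d k + rate_increment d (k div d)"
proof -
  define m j where "m = k div d" and "j = k mod d"
  have k: "k = m * d + j" and j: "j < d" using d by (simp_all add: m_def j_def)
  have "rate_exponent d (m * d + Suc j) \<le> rate_exponent d (m * d + j) + rate_increment d m"
  proof (cases "Suc j < d")
    case True
    then show ?thesis
      unfolding rate_exponent_period[OF j] rate_exponent_period[OF True]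
      by (simp add: algebra_simps)
  next
    case False
    then have "m * d + Suc j = Suc m * d" using j by simp
    then have "rate_exponent d (m * d + Suc j) =
        (if even (Suc m) then 1 else 1 + real d) * rate_increment d (Suc m)"
      by (simp only: rate_exponent_mult[OF d])
    \<comment> \<open>Exactly one of \<open>m\<close> and \<open>Suc m\<close> is odd, so the factor
      \<open>1 + real d\<close> appears once for either parity.\<close>
    also have "\<dots> = (1 + real d) * rate_increment d m"
      by (simp add: rate_increment_Suc)
    \<comment> \<open>Here \<open>Suc j = d\<close>; equality holds for even \<open>m\<close>, and
      there is slack for odd \<open>m\<close>.\<close>
    also have "\<dots> \<le> ((1 + real d) ^ (m mod 2) + real (Suc j)) * rate_increment d m"
    proof (rule mult_right_mono)
      show "1 + real d \<le> (1 + real d) ^ (m mod 2) + real (Suc j)"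
        using \<open>\<not> Suc j < d\<close> one_le_power[of "1 + real d" "m mod 2"] by linarith
    qed (rule less_imp_le[OF rate_increment_pos])
    also have "\<dots> = rate_exponent d (m * d + j) + rate_increment d m"
      unfolding rate_exponent_period[OF j] by (simp add: algebra_simps)
    finally show ?thesis .
  qed
  then show ?thesis by (simp only: add_Suc_right flip: k m_def)
qed

text \<open>The first bound decides the maximum in the recursion in favour of the reference round;
  the second closes the induction step.\<close>

lemma rate_exponent_reference_round:
  assumes d: "d > 0" and k: "k \<ge> d"
  shows "rate_exponent d (reference_round d k) \<le> rate_exponent d k"
    and "rate_exponent d (Suc k) \<le> rate_exponent d k + rate_exponent d (reference_round d k)"
proof -
  have m: "k div d \<ge> 1" using d k by (simp add: div_greater_zero_iff Suc_leI)
  have "rate_exponent d (k div d * d) \<le> rate_exponent d (k div d * d + k mod d)"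
    using rate_exponent_period[of 0 d "k div d"] rate_exponent_period[of "k mod d" d "k div d"] d
      rate_increment_pos[of d "k div d"]
    by (simp add: algebra_simps del: div_mult_mod_eq mult_div_mod_eq)
  then show "rate_exponent d (reference_round d k) \<le> rate_exponent d k"
    using rate_exponent_reference_bounds(2)[OF d m] by (simp add: reference_round_def)
  show "rate_exponent d (Suc k) \<le> rate_exponent d k + rate_exponent d (reference_round d k)"
    using rate_exponent_reference_bounds(1)[OF d m] rate_exponent_Suc_le[OF d, of k]
    by (simp add: reference_round_def)
qed

lemma reference_round_bounds:
  assumes "d > 0" "k \<ge> d"
  shows "d \<le> reference_round d k" "reference_round d k \<le> k"
proof -
  have m: "k div d \<ge> 1" using assms by (simp add: div_greater_zero_iff Suc_leI)
  show "d \<le> reference_round d k" by (simp add: reference_round_def)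
  have "max 1 (k div d - 1) * d \<le> k div d * d" using m by (intro mult_right_mono) auto
  also have "\<dots> \<le> k" by simp
  finally show "reference_round d k \<le> k" by (simp add: reference_round_def)
qed

section \<open>Solving the recursion and the final rate\<close>

text \<open>Strong induction, since the recursion reaches back to the reference round. A product of
  powers adds exponents, and since the base is below 1, smaller exponents give larger
  bounds.\<close>

lemma lazy_recursion_rate:
  fixes a :: "nat \<Rightarrow> real"
  assumes d: "d > 0"
    and nonneg: "\<And>k. a k \<ge> 0"
    and start: "a d \<le> 1 / 2"
    and step: "\<And>k. k \<ge> d \<Longrightarrow> a (Suc k) \<le> a k * max (a k) (a (reference_round d k))"
    and k: "k \<ge> d"
  shows "a k \<le> (1 / 2) powr rate_exponent d k"
  using k
proof (induction k rule: less_induct)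
  case (less k)
  show ?case
  proof (cases "k = d")
    case True
    then show ?thesis using start rate_exponent_first_period[OF d] by simp
  next
    case False
    then obtain l where l: "k = Suc l" "l \<ge> d" using less.prems by (cases k) auto
    let ?h = "rate_exponent d" and ?r = "reference_round d l"
    have "a ?r \<le> (1 / 2) powr ?h ?r"
      using reference_round_bounds[OF d l(2)] l by (intro less.IH) auto
    moreover have al: "a l \<le> (1 / 2) powr ?h l" using less.IH l by simp
    moreover have "(1 / 2) powr ?h l \<le> (1 / 2 :: real) powr ?h ?r"
      using rate_exponent_reference_round(1)[OF d l(2)] by (intro powr_mono') auto
    ultimately have m: "max (a l) (a ?r) \<le> (1 / 2) powr ?h ?r" by simp
    have "a k \<le> a l * max (a l) (a ?r)" using step l by simp
    also have "\<dots> \<le> (1 / 2) powr ?h l * (1 / 2) powr ?h ?r"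
      using al m nonneg by (intro mult_mono) (auto simp: le_max_iff_disj)
    also have "\<dots> = (1 / 2) powr (?h l + ?h ?r)" by (simp add: powr_add)
    also have "\<dots> \<le> (1 / 2) powr ?h k"
      using rate_exponent_reference_round(2)[OF d l(2)] l by (intro powr_mono') auto
    finally show ?thesis .
  qed
qed

theorem theorem3p6:
  fixes F :: "nat \<Rightarrow> real ^ 'd::finite \<Rightarrow> real"
    and f :: "real ^ 'd \<Rightarrow> real"
    and n k :: nat
    and idx :: "nat \<Rightarrow> 'd"
    and L \<mu> M :: real
    and x0 :: "real ^ 'd"
    and x xt :: "nat \<Rightarrow> real ^ 'd"
    and H Hp :: "nat \<Rightarrow> real ^ 'd ^ 'd"
  assumes n: "n \<ge> 1"
    and f: "\<And>y. f y = 1 / real n * (\<Sum>i = 1..n. F i y)"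
    and smooth: "\<And>i. i \<in> {1..n} \<Longrightarrow> twice_differentiable (F i)"
    and L: "L > 0"
    and lipschitz: "\<And>y z. spectral_norm (hessian f y - hessian f z) \<le> L * norm (y - z)"
    and mu: "\<mu> > 0"
    and convex: "\<And>y. loewner_ge (hessian f y) (\<mu> *\<^sub>R mat 1)"
    and M: "M \<ge> 0"
    and init: "norm (gradient f x0) \<le> \<mu>\<^sup>2 / (2 * (M + 3 * L))"
    and idx: "bij_betw idx {1..CARD('d)} UNIV"
    and run: "c2eden_run idx n F M x0 x xt H Hp"
    and k: "k \<ge> CARD('d)"
  shows "norm (gradient f (x k)) \<le>
    \<mu>\<^sup>2 / (M + 3 * L) * (1 / 2) powr rate_exponent (CARD('d)) k"
proof -
  let ?d = "CARD('d)"
  \<comment> \<open>Scaling the gradient norms by \<open>c\<close> removes the constant from the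
    recursion and turns the condition on \<open>x0\<close> into
    \<open>a ?d \<le> 1 / 2\<close>.\<close>
  define c where "c = (M + 3 * L) / \<mu>\<^sup>2"
  have c: "c > 0" using M L mu by (simp add: c_def)
  define a where "a k = c * norm (gradient f (x k))" for k
  have f2: "twice_differentiable f"
    by (rule twice_differentiable_client_average[OF f smooth])
  have "x ?d = x0" using run by (simp add: c2eden_run_def Let_def)
  then have start: "a ?d \<le> 1 / 2"
    using init M L mu by (simp add: a_def c_def field_simps)
  have c_max: "c * max u v = max (c * u) (c * v)" for u v
    using c by (simp add: max_mult_distrib_left)
  have step: "a (Suc k) \<le> a k * max (a k) (a (reference_round ?d k))" if k: "k \<ge> ?d" for k
  proof -
    have "norm (gradient f (x (Suc k))) \<le> c * (norm (gradient f (x k)) *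
        max (norm (gradient f (x k))) (norm (gradient f (x (reference_round ?d k)))))"
      unfolding c_def
      by (rule lazy_cubic_step_gradient_bound[OF f2 L lipschitz mu convex M
            c2eden_run_step[OF f smooth idx run k]])
    then have "a (Suc k) \<le> c * (c * (norm (gradient f (x k)) *
        max (norm (gradient f (x k))) (norm (gradient f (x (reference_round ?d k))))))"
      unfolding a_def using c by (rule mult_left_mono[OF _ less_imp_le])
    also have "\<dots> = a k * (c * max (norm (gradient f (x k))) (norm (gradient f (x (reference_round ?d k)))))"
      by (simp only: a_def mult_ac)
    also have "\<dots> = a k * max (a k) (a (reference_round ?d k))"
      unfolding a_def by (simp only: c_max)
    finally show ?thesis .
  qed
  have "a k \<le> (1 / 2) powr rate_exponent ?d k"
    using c start step k by (intro lazy_recursion_rate) (auto simp: a_def)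
  then show ?thesis
    using M L mu by (simp add: a_def c_def field_simps)
qed

end
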